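(* Let $f\colon P\to Q$ be a surjective quandle homomorphism. Then $f$ is connected if and only if there is some normal subgroup $N\subseteq \mathrm{Inn}(P)$ such that $f$ is isomorphic to the quotient map $\pi_N\colon P\to P/N$ as quotients of $P$.
   Context: A quandle is a set $Q$ with bijections $s_x\colon Q\to Q$ ($x\in Q$) such that $s_x(x)=x$ and $s_x\circ s_y=s_{s_x(y)}\circ s_x$ for all $x,y\in Q$. A quandle homomorphism $f\colon P\to Q$ is a map with $f(s_x(y))=s_{f(x)}(f(y))$ for all $x,y\in P$. The inner automorphism group $\mathrm{Inn}(P)$ is the group of permutations of $P$ generated by all $s_x$, $x\in P$. A surjective quandle homomorphism $f\colon P\to Q$ induces a surjective group homomorphism $f_*\colon\mathrm{Inn}(P)\to\mathrm{Inn}(Q)$, where $f_*(\varphi)$ is the unique element of $\mathrm{Inn}(Q)$ with $f\circ\varphi=f_*(\varphi)\circ f$. The relative inner automorphism group of $f$ is $\mathrm{Inn}_{\mathrm{rel}}(f)=\ker(f_* )$; it preserves each fiber of $f$. The homomorphism $f$ is called connected if it is surjective and for each $q\in Q$ the group $\mathrm{Inn}_{\mathrm{rel}}(f)$ acts transitively on the fiber $f^{-1}(q)$. For a normal subgroup $N$ of $\mathrm{Inn}(P)$, $P/N$ denotes the set of $N$-orbits in $P$ with the (well-defined) quandle structure $s_{[x]}([y])=[s_x(y)]$, and $\pi_N\colon P\to P/N$ is the natural quotient homomorphism. Two surjective homomorphisms $f\colon P\to Q$ and $f'\colon P\to Q'$ are isomorphic as quotients of $P$ if there is a quandle isomorphism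 $\theta\colon Q\to Q'$ with $\theta\circ f=f'$. *)

theory Defs
  imports "HOL-Algebra.Group_Action" "HOL-Algebra.Elementary_Groups"
begin

section \<open>Quandles and their homomorphisms\<close>

text \<open>\<open>qsym Q x\<close> is the symmetry $s_x$; only its values on the carrier matter.\<close>

record 'a quandle = "'a partial_object" +
  qsym :: "'a \<Rightarrow> 'a \<Rightarrow> 'a"

locale quandle =
  fixes Q :: "'a quandle" (structure)
  assumes qsym_bij: "x \<in> carrier Q \<Longrightarrow> bij_betw (qsym Q x) (carrier Q) (carrier Q)"
    and qsym_fix: "x \<in> carrier Q \<Longrightarrow> qsym Q x x = x"
    and qsym_distrib: "\<lbrakk>x \<in> carrier Q; y \<in> carrier Q; z \<in> carrier Q\<rbrakk>
      \<Longrightarrow> qsym Q x (qsym Q y z) = qsym Q (qsym Q x y) (qsym Q x z)"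

locale quandle_hom = P: quandle P + Q: quandle Q
  for P :: "'a quandle" and Q :: "'b quandle" +
  fixes f :: "'a \<Rightarrow> 'b"
  assumes hom_closed: "f \<in> carrier P \<rightarrow> carrier Q"
    and hom_qsym: "\<lbrakk>x \<in> carrier P; y \<in> carrier P\<rbrakk>
      \<Longrightarrow> f (qsym P x y) = qsym Q (f x) (f y)"

locale surj_quandle_hom = quandle_hom +
  assumes surj: "f ` carrier P = carrier Q"

locale quandle_iso = quandle_hom +
  assumes bij: "bij_betw f (carrier P) (carrier Q)"

section \<open>Inner automorphisms\<close>

text \<open>Permutations of the carrier are taken extensional, as in \<^const>\<open>BijGroup\<close>;
  hence the restriction of each symmetry to the carrier.\<close>

definition Inn :: "'a quandle \<Rightarrow> ('a \<Rightarrow> 'a) monoid" where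
  "Inn P = subgroup_generated (BijGroup (carrier P))
     ((\<lambda>x. restrict (qsym P x) (carrier P)) ` carrier P)"

text \<open>The homomorphism $f_*$; see \<open>ex1_induced_Inn\<close> below for unique existence.\<close>

definition induced_Inn ::
    "'a quandle \<Rightarrow> 'b quandle \<Rightarrow> ('a \<Rightarrow> 'b) \<Rightarrow> ('a \<Rightarrow> 'a) \<Rightarrow> 'b \<Rightarrow> 'b" where
  "induced_Inn P Q f \<phi> =
     (THE \<psi>. \<psi> \<in> carrier (Inn Q) \<and> (\<forall>x\<in>carrier P. f (\<phi> x) = \<psi> (f x)))"

definition Inn_rel :: "'a quandle \<Rightarrow> 'b quandle \<Rightarrow> ('a \<Rightarrow> 'b) \<Rightarrow> ('a \<Rightarrow> 'a) set" where
  "Inn_rel P Q f = kernel (Inn P) (Inn Q) (induced_Inn P Q f)"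

definition fiber :: "'a quandle \<Rightarrow> ('a \<Rightarrow> 'b) \<Rightarrow> 'b \<Rightarrow> 'a set" where
  "fiber P f q = {x \<in> carrier P. f x = q}"

definition connected_quandle_hom :: "'a quandle \<Rightarrow> 'b quandle \<Rightarrow> ('a \<Rightarrow> 'b) \<Rightarrow> bool" where
  "connected_quandle_hom P Q f \<longleftrightarrow> surj_quandle_hom P Q f \<and>
     (\<forall>q\<in>carrier Q. transitive_action (Inn P\<lparr>carrier := Inn_rel P Q f\<rparr>)
        (fiber P f q) (\<lambda>\<phi>. restrict \<phi> (fiber P f q)))"

section \<open>Quotients\<close>

definition quotient_map :: "'a quandle \<Rightarrow> ('a \<Rightarrow> 'a) set \<Rightarrow> 'a \<Rightarrow> 'a set" where
  "quotient_map P N = orbit (Inn P\<lparr>carrier := N\<rparr>) (\<lambda>\<phi>. \<phi>)"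

text \<open>The union in the symmetry runs over all choices of representatives $x \in A$, $y \in B$;
  for normal $N$ all the orbits $[s_x(y)]$ coincide, see \<open>quotient_qsym\<close> below.\<close>

definition quotient_quandle :: "'a quandle \<Rightarrow> ('a \<Rightarrow> 'a) set \<Rightarrow> 'a set quandle" where
  "quotient_quandle P N =
     \<lparr>carrier = orbits (Inn P\<lparr>carrier := N\<rparr>) (carrier P) (\<lambda>\<phi>. \<phi>),
      qsym = (\<lambda>A B. \<Union>x\<in>A. \<Union>y\<in>B. quotient_map P N (qsym P x y))\<rparr>"

definition isomorphic_quotients ::
    "'a quandle \<Rightarrow> 'b quandle \<Rightarrow> ('a \<Rightarrow> 'b) \<Rightarrow> 'c quandle \<Rightarrow> ('a \<Rightarrow> 'c) \<Rightarrow> bool" where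
  "isomorphic_quotients P Q f Q' f' \<longleftrightarrow>
     (\<exists>\<theta>. quandle_iso Q Q' \<theta> \<and> (\<forall>x\<in>carrier P. \<theta> (f x) = f' x))"

section \<open>Well-definedness\<close>

context quandle
begin

lemma qsym_closed: "\<lbrakk>x \<in> carrier Q; y \<in> carrier Q\<rbrakk> \<Longrightarrow> qsym Q x y \<in> carrier Q"
  by (rule bij_betw_apply[OF qsym_bij])

lemma restrict_qsym_Bij: "x \<in> carrier Q \<Longrightarrow> restrict (qsym Q x) (carrier Q) \<in> Bij (carrier Q)"
  using qsym_bij by (simp add: Bij_def cong: bij_betw_cong)

lemma group_Inn: "group (Inn Q)"
  unfolding Inn_def by (intro group.group_subgroup_generated group_BijGroup)

lemma carrier_Inn:
  "carrier (Inn Q) = generate (BijGroup (carrier Q))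
     ((\<lambda>x. restrict (qsym Q x) (carrier Q)) ` carrier Q)"
proof -
  have "(\<lambda>x. restrict (qsym Q x) (carrier Q)) ` carrier Q \<subseteq> carrier (BijGroup (carrier Q))"
    using restrict_qsym_Bij by (auto simp: BijGroup_def)
  then show ?thesis
    unfolding Inn_def carrier_subgroup_generated by (simp add: Int_absorb1)
qed

lemma qsym_in_Inn: "x \<in> carrier Q \<Longrightarrow> restrict (qsym Q x) (carrier Q) \<in> carrier (Inn Q)"
  unfolding carrier_Inn by (rule generate.incl) auto

lemma Inn_Bij: "\<phi> \<in> carrier (Inn Q) \<Longrightarrow> \<phi> \<in> Bij (carrier Q)"
  using subsetD[OF group.carrier_subgroup_generated_subset[OF group_BijGroup]]
  by (fastforce simp: Inn_def BijGroup_def)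

lemma Inn_closed: "\<lbrakk>\<phi> \<in> carrier (Inn Q); x \<in> carrier Q\<rbrakk> \<Longrightarrow> \<phi> x \<in> carrier Q"
  using Bij_imp_funcset[OF Inn_Bij, of \<phi>] by (rule funcset_mem)

lemma Inn_one: "\<one>\<^bsub>Inn Q\<^esub> = (\<lambda>x\<in>carrier Q. x)"
  by (simp add: Inn_def BijGroup_def)

lemma Inn_mult:
  "\<lbrakk>\<phi> \<in> carrier (Inn Q); \<psi> \<in> carrier (Inn Q)\<rbrakk>
   \<Longrightarrow> \<phi> \<otimes>\<^bsub>Inn Q\<^esub> \<psi> = compose (carrier Q) \<phi> \<psi>"
  using Inn_Bij[of \<phi>] Inn_Bij[of \<psi>] by (simp add: Inn_def BijGroup_def)

lemma Inn_mult_apply: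
  "\<lbrakk>\<phi> \<in> carrier (Inn Q); \<psi> \<in> carrier (Inn Q); x \<in> carrier Q\<rbrakk>
   \<Longrightarrow> (\<phi> \<otimes>\<^bsub>Inn Q\<^esub> \<psi>) x = \<phi> (\<psi> x)"
  by (subst Inn_mult) (simp_all only: compose_eq)

lemma Inn_inv_left:
  assumes "\<phi> \<in> carrier (Inn Q)" "x \<in> carrier Q"
  shows "(inv\<^bsub>Inn Q\<^esub> \<phi>) (\<phi> x) = x"
  using assms Inn_mult_apply[of "inv\<^bsub>Inn Q\<^esub> \<phi>" \<phi> x] group_Inn
  by (simp add: group.l_inv group.inv_closed Inn_one)

lemma Inn_inv_right:
  assumes "\<phi> \<in> carrier (Inn Q)" "x \<in> carrier Q"
  shows "\<phi> ((inv\<^bsub>Inn Q\<^esub> \<phi>) x) = x"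
  using assms Inn_mult_apply[of \<phi> "inv\<^bsub>Inn Q\<^esub> \<phi>" x] group_Inn
  by (simp add: group.r_inv group.inv_closed Inn_one)

lemma Inn_eqI:
  assumes "\<phi> \<in> carrier (Inn Q)" "\<psi> \<in> carrier (Inn Q)" "\<And>x. x \<in> carrier Q \<Longrightarrow> \<phi> x = \<psi> x"
  shows "\<phi> = \<psi>"
  using assms(3)
  by (rule extensionalityI[OF Bij_imp_extensional[OF Inn_Bij[OF assms(1)]]
        Bij_imp_extensional[OF Inn_Bij[OF assms(2)]]])

lemma Inn_induct [consumes 1, case_names one incl inv mult]:
  assumes "\<phi> \<in> carrier (Inn Q)"
    and "R (\<lambda>x\<in>carrier Q. x)"
    and "\<And>x. x \<in> carrier Q \<Longrightarrow> R (restrict (qsym Q x) (carrier Q))"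
    and "\<And>\<phi>. \<lbrakk>\<phi> \<in> carrier (Inn Q); R \<phi>\<rbrakk> \<Longrightarrow> R (inv\<^bsub>Inn Q\<^esub> \<phi>)"
    and "\<And>\<phi> \<psi>. \<lbrakk>\<phi> \<in> carrier (Inn Q); \<psi> \<in> carrier (Inn Q); R \<phi>; R \<psi>\<rbrakk>
      \<Longrightarrow> R (compose (carrier Q) \<phi> \<psi>)"
  shows "R \<phi>"
proof -
  let ?S = "(\<lambda>x. restrict (qsym Q x) (carrier Q)) ` carrier Q"
  have inv_eq: "inv\<^bsub>BijGroup (carrier Q)\<^esub> h = inv\<^bsub>Inn Q\<^esub> h" if "h \<in> carrier (Inn Q)" for h
    using that group.inv_subgroup_generated[OF group_BijGroup, of h "carrier Q" ?S]
    by (simp add: Inn_def)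
  have mult_eq: "g \<otimes>\<^bsub>BijGroup (carrier Q)\<^esub> h = g \<otimes>\<^bsub>Inn Q\<^esub> h" for g h
    by (simp add: Inn_def)
  show ?thesis
    using assms(1) unfolding carrier_Inn
  proof (induction rule: generate.induct)
    case one
    have "\<one>\<^bsub>BijGroup (carrier Q)\<^esub> = (\<lambda>x\<in>carrier Q. x)" by (simp add: BijGroup_def)
    then show ?case using assms(2) by (simp only:)
  next
    case (incl h)
    then show ?case using assms(3) by blast
  next
    case (inv h)
    then obtain x where x: "x \<in> carrier Q" "h = restrict (qsym Q x) (carrier Q)" by auto
    have h: "h \<in> carrier (Inn Q)" using x qsym_in_Inn by blast
    show ?case unfolding inv_eq[OF h] using assms(3,4) h x by blast
  next
    case (eng g h)
    then have gh: "g \<in> carrier (Inn Q)" "h \<in> carrier (Inn Q)" by (simp_all only: carrier_Inn)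
    show ?case unfolding mult_eq Inn_mult[OF gh] using assms(5) gh eng.IH by blast
  qed
qed

lemma Inn_qsym:
  assumes "\<phi> \<in> carrier (Inn Q)" "x \<in> carrier Q" "y \<in> carrier Q"
  shows "\<phi> (qsym Q x y) = qsym Q (\<phi> x) (\<phi> y)"
  using assms
proof (induction \<phi> arbitrary: x y rule: Inn_induct)
  case one
  then show ?case by (simp add: qsym_closed)
next
  case (incl z)
  then show ?case using qsym_distrib[of z x y] by (simp add: qsym_closed)
next
  case (inv \<phi>)
  have i: "inv\<^bsub>Inn Q\<^esub> \<phi> \<in> carrier (Inn Q)"
    using inv by (simp add: group.inv_closed group_Inn)
  have "\<phi> (qsym Q ((inv\<^bsub>Inn Q\<^esub> \<phi>) x) ((inv\<^bsub>Inn Q\<^esub> \<phi>) y)) = qsym Q x y"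
    using inv i by (simp add: Inn_closed Inn_inv_right)
  then show ?case
    using inv i Inn_closed Inn_inv_left qsym_closed by metis
next
  case (mult \<phi> \<psi>)
  then show ?case by (simp add: compose_eq qsym_closed Inn_closed)
qed

end

context surj_quandle_hom
begin

lemma f_closed: "x \<in> carrier P \<Longrightarrow> f x \<in> carrier Q"
  using hom_closed by auto

lemma ex_induced_Inn:
  assumes "\<phi> \<in> carrier (Inn P)"
  shows "\<exists>\<psi>. \<psi> \<in> carrier (Inn Q) \<and> (\<forall>x\<in>carrier P. f (\<phi> x) = \<psi> (f x))"
  using assms
proof (induction \<phi> rule: P.Inn_induct)
  case one
  have "(\<lambda>x\<in>carrier Q. x) \<in> carrier (Inn Q)"
    using group.is_monoid[OF Q.group_Inn, THEN monoid.one_closed] by (simp only: Q.Inn_one)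
  moreover have "\<forall>x\<in>carrier P. f ((\<lambda>x\<in>carrier P. x) x) = (\<lambda>x\<in>carrier Q. x) (f x)"
    by (simp add: f_closed)
  ultimately show ?case by blast
next
  case (incl x)
  then have "\<forall>y\<in>carrier P. f (restrict (qsym P x) (carrier P) y) =
      restrict (qsym Q (f x)) (carrier Q) (f y)"
    by (simp add: f_closed hom_qsym)
  then show ?case using incl f_closed Q.qsym_in_Inn by blast
next
  case (inv \<phi>)
  then obtain \<psi> where \<psi>: "\<psi> \<in> carrier (Inn Q)" "\<forall>x\<in>carrier P. f (\<phi> x) = \<psi> (f x)" by blast
  have i: "inv\<^bsub>Inn P\<^esub> \<phi> \<in> carrier (Inn P)"
    using inv by (simp add: group.inv_closed P.group_Inn)
  have "f ((inv\<^bsub>Inn P\<^esub> \<phi>) x) = (inv\<^bsub>Inn Q\<^esub> \<psi>) (f x)" if "x \<in> carrier P" for x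
  proof -
    have c: "(inv\<^bsub>Inn P\<^esub> \<phi>) x \<in> carrier P" using i that by (rule P.Inn_closed)
    have "\<psi> (f ((inv\<^bsub>Inn P\<^esub> \<phi>) x)) = f x"
      using \<psi>(2) c P.Inn_inv_right[OF inv.hyps that] by metis
    then show ?thesis using Q.Inn_inv_left[OF \<psi>(1) f_closed[OF c]] by simp
  qed
  moreover have "inv\<^bsub>Inn Q\<^esub> \<psi> \<in> carrier (Inn Q)"
    using \<psi>(1) by (rule group.inv_closed[OF Q.group_Inn])
  ultimately show ?case by blast
next
  case (mult \<phi> \<phi>')
  then obtain \<psi> \<psi>' where
    \<psi>: "\<psi> \<in> carrier (Inn Q)" "\<forall>x\<in>carrier P. f (\<phi> x) = \<psi> (f x)" and
    \<psi>': "\<psi>' \<in> carrier (Inn Q)" "\<forall>x\<in>carrier P. f (\<phi>' x) = \<psi>' (f x)" by blast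
  have "\<psi> \<otimes>\<^bsub>Inn Q\<^esub> \<psi>' \<in> carrier (Inn Q)"
    using \<psi> \<psi>' Q.group_Inn by (simp add: group.is_monoid monoid.m_closed)
  moreover have "f (compose (carrier P) \<phi> \<phi>' x) = (\<psi> \<otimes>\<^bsub>Inn Q\<^esub> \<psi>') (f x)" if "x \<in> carrier P" for x
    using that \<psi> \<psi>' mult.hyps by (simp add: compose_eq P.Inn_closed Q.Inn_mult_apply f_closed)
  ultimately show ?case by blast
qed

lemma ex1_induced_Inn:
  assumes "\<phi> \<in> carrier (Inn P)"
  shows "\<exists>!\<psi>. \<psi> \<in> carrier (Inn Q) \<and> (\<forall>x\<in>carrier P. f (\<phi> x) = \<psi> (f x))"
proof -
  have "\<psi> = \<psi>'" if "\<psi> \<in> carrier (Inn Q)" "\<forall>x\<in>carrier P. f (\<phi> x) = \<psi> (f x)"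
    "\<psi>' \<in> carrier (Inn Q)" "\<forall>x\<in>carrier P. f (\<phi> x) = \<psi>' (f x)" for \<psi> \<psi>'
  proof (rule Q.Inn_eqI[OF that(1,3)])
    fix y assume "y \<in> carrier Q"
    then obtain x where "x \<in> carrier P" "y = f x" using surj by blast
    then show "\<psi> y = \<psi>' y" using that(2,4) by metis
  qed
  then show ?thesis using ex_induced_Inn[OF assms] by (metis (no_types, lifting))
qed

lemma induced_Inn:
  assumes "\<phi> \<in> carrier (Inn P)"
  shows "induced_Inn P Q f \<phi> \<in> carrier (Inn Q)"
    and "\<And>x. x \<in> carrier P \<Longrightarrow> f (\<phi> x) = induced_Inn P Q f \<phi> (f x)"
proof -
  have *: "induced_Inn P Q f \<phi> \<in> carrier (Inn Q) \<and>
      (\<forall>x\<in>carrier P. f (\<phi> x) = induced_Inn P Q f \<phi> (f x))"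
    unfolding induced_Inn_def by (rule theI'[OF ex1_induced_Inn[OF assms]])
  show "induced_Inn P Q f \<phi> \<in> carrier (Inn Q)" using * by (rule conjunct1)
  show "f (\<phi> x) = induced_Inn P Q f \<phi> (f x)" if "x \<in> carrier P" for x
    using conjunct2[OF *] that by (rule bspec)
qed

lemma group_hom_induced_Inn: "group_hom (Inn P) (Inn Q) (induced_Inn P Q f)"
proof -
  have "induced_Inn P Q f (\<phi> \<otimes>\<^bsub>Inn P\<^esub> \<phi>') = induced_Inn P Q f \<phi> \<otimes>\<^bsub>Inn Q\<^esub> induced_Inn P Q f \<phi>'"
    if a: "\<phi> \<in> carrier (Inn P)" "\<phi>' \<in> carrier (Inn P)" for \<phi> \<phi>'
  proof -
    have m: "\<phi> \<otimes>\<^bsub>Inn P\<^esub> \<phi>' \<in> carrier (Inn P)"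
      using a P.group_Inn by (simp add: group.is_monoid monoid.m_closed)
    show ?thesis
    proof (rule Q.Inn_eqI)
      show "induced_Inn P Q f (\<phi> \<otimes>\<^bsub>Inn P\<^esub> \<phi>') \<in> carrier (Inn Q)"
        using induced_Inn m by blast
      show "induced_Inn P Q f \<phi> \<otimes>\<^bsub>Inn Q\<^esub> induced_Inn P Q f \<phi>' \<in> carrier (Inn Q)"
        using a induced_Inn Q.group_Inn by (simp add: group.is_monoid monoid.m_closed)
      fix y assume "y \<in> carrier Q"
      then obtain x where x: "x \<in> carrier P" "y = f x" using surj by auto
      have "induced_Inn P Q f (\<phi> \<otimes>\<^bsub>Inn P\<^esub> \<phi>') y = f (\<phi> (\<phi>' x))"
        using x a induced_Inn(2)[OF m] by (simp add: P.Inn_mult_apply)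
      also have "\<dots> = induced_Inn P Q f \<phi> (induced_Inn P Q f \<phi>' y)"
        using x a by (simp add: induced_Inn(2)[symmetric] P.Inn_closed)
      finally show "induced_Inn P Q f (\<phi> \<otimes>\<^bsub>Inn P\<^esub> \<phi>') y =
          (induced_Inn P Q f \<phi> \<otimes>\<^bsub>Inn Q\<^esub> induced_Inn P Q f \<phi>') y"
        using a x by (simp add: Q.Inn_mult_apply induced_Inn(1) f_closed)
    qed
  qed
  then show ?thesis
    by (auto intro!: group_hom.intro group_hom_axioms.intro homI
        simp: P.group_Inn Q.group_Inn induced_Inn(1))
qed

lemma Inn_rel_fiber:
  assumes "\<phi> \<in> Inn_rel P Q f" "x \<in> fiber P f q"
  shows "\<phi> x \<in> fiber P f q"
proof -
  have x: "x \<in> carrier P" "f x = q" and \<phi>: "\<phi> \<in> carrier (Inn P)"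
    "induced_Inn P Q f \<phi> = \<one>\<^bsub>Inn Q\<^esub>"
    using assms by (auto simp: fiber_def Inn_rel_def kernel_def)
  then have "f (\<phi> x) = q"
    using induced_Inn(2)[OF \<phi>(1) x(1)] f_closed[OF x(1)] by (simp add: Q.Inn_one)
  then show ?thesis using x \<phi> by (simp add: fiber_def P.Inn_closed)
qed

lemma subgroup_Inn_rel: "subgroup (Inn_rel P Q f) (Inn P)"
  unfolding Inn_rel_def by (rule group_hom.subgroup_kernel[OF group_hom_induced_Inn])

lemma group_action_fiber:
  "group_action (Inn P\<lparr>carrier := Inn_rel P Q f\<rparr>) (fiber P f q)
     (\<lambda>\<phi>. restrict \<phi> (fiber P f q))"
proof -
  interpret K: subgroup "Inn_rel P Q f" "Inn P" by (rule subgroup_Inn_rel)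
  have sub: "\<phi> \<in> carrier (Inn P)" if "\<phi> \<in> Inn_rel P Q f" for \<phi>
    using that K.subset by blast
  have fP: "x \<in> carrier P" if "x \<in> fiber P f q" for x using that by (simp add: fiber_def)
  have bij: "restrict \<phi> (fiber P f q) \<in> Bij (fiber P f q)" if \<phi>: "\<phi> \<in> Inn_rel P Q f" for \<phi>
  proof -
    have "inv\<^bsub>Inn P\<^esub> \<phi> \<in> Inn_rel P Q f" using \<phi> by simp
    then have "bij_betw \<phi> (fiber P f q) (fiber P f q)"
      using \<phi> by (intro bij_betw_byWitness[of _ "inv\<^bsub>Inn P\<^esub> \<phi>"])
        (auto simp: sub fP Inn_rel_fiber P.Inn_inv_left P.Inn_inv_right)
    then show ?thesis by (simp add: Bij_def cong: bij_betw_cong)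
  qed
  have "restrict (\<phi> \<otimes>\<^bsub>Inn P\<^esub> \<psi>) (fiber P f q) =
      compose (fiber P f q) (restrict \<phi> (fiber P f q)) (restrict \<psi> (fiber P f q))"
    if "\<phi> \<in> Inn_rel P Q f" "\<psi> \<in> Inn_rel P Q f" for \<phi> \<psi>
    using that by (auto simp: fun_eq_iff compose_def P.Inn_mult_apply sub fP Inn_rel_fiber)
  then show ?thesis
    using subgroup.subgroup_is_group[OF subgroup_Inn_rel P.group_Inn] group_BijGroup bij
    by (auto intro!: group_action.intro group_hom.intro group_hom_axioms.intro homI
        simp: BijGroup_def)
qed

end

context quandle
begin

context
  fixes N assumes N: "N \<lhd> Inn Q"
begin

interpretation N: normal N "Inn Q" by (rule N)

lemma quotient_map_iff:
  "y \<in> quotient_map Q N x \<longleftrightarrow> (\<exists>n\<in>N. y = n x)"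
  by (simp add: quotient_map_def orbit_def Bex_def conj_commute)

lemma quotient_map_refl: "x \<in> carrier Q \<Longrightarrow> x \<in> quotient_map Q N x"
proof -
  assume "x \<in> carrier Q"
  then have "x = \<one>\<^bsub>Inn Q\<^esub> x" by (simp add: Inn_one)
  then show ?thesis unfolding quotient_map_iff using subgroup.one_closed[OF N.subgroup_axioms] by blast
qed

lemma quotient_map_eq:
  assumes "x \<in> carrier Q" "n \<in> N"
  shows "quotient_map Q N (n x) = quotient_map Q N x"
proof -
  have sub: "m \<in> carrier (Inn Q)" if "m \<in> N" for m using that N.subset by blast
  have "\<exists>m'\<in>N. m (n x) = m' x" if "m \<in> N" for m
    using Inn_mult_apply[OF sub[OF that] sub[OF assms(2)] assms(1)]
      subgroup.m_closed[OF N.subgroup_axioms that assms(2)] by metis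
  moreover have "\<exists>m'\<in>N. m x = m' (n x)" if "m \<in> N" for m
  proof -
    have i: "inv\<^bsub>Inn Q\<^esub> n \<in> N" using assms(2) by (rule subgroup.m_inv_closed[OF N.subgroup_axioms])
    have "(m \<otimes>\<^bsub>Inn Q\<^esub> inv\<^bsub>Inn Q\<^esub> n) (n x) = m x"
      using Inn_mult_apply[OF sub[OF that] sub[OF i] Inn_closed[OF sub[OF assms(2)] assms(1)]]
        Inn_inv_left[OF sub[OF assms(2)] assms(1)] by simp
    then show ?thesis using subgroup.m_closed[OF N.subgroup_axioms that i] by metis
  qed
  ultimately show ?thesis unfolding set_eq_iff quotient_map_iff by metis
qed

lemma quotient_map_eq_iff:
  assumes "x \<in> carrier Q" "y \<in> carrier Q"
  shows "quotient_map Q N x = quotient_map Q N y \<longleftrightarrow> (\<exists>n\<in>N. y = n x)"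
  using assms quotient_map_eq quotient_map_refl quotient_map_iff by metis

lemma carrier_quotient: "carrier (quotient_quandle Q N) = quotient_map Q N ` carrier Q"
  by (auto simp: quotient_quandle_def orbits_def quotient_map_def)

lemma quotient_map_qsym_cong:
  assumes xy: "x \<in> carrier Q" "y \<in> carrier Q" and mn: "m \<in> N" "n \<in> N"
  shows "quotient_map Q N (qsym Q (m x) (n y)) = quotient_map Q N (qsym Q x y)"
proof -
  have sub: "k \<in> carrier (Inn Q)" if "k \<in> N" for k using that N.subset by blast
  let ?G = "Inn Q"
  let ?s = "restrict (qsym Q x) (carrier Q)"
  define k where "k = inv\<^bsub>?G\<^esub> m \<otimes>\<^bsub>?G\<^esub> n"
  have k: "k \<in> N" using mn by (simp add: k_def)
  have s: "?s \<in> carrier ?G" using xy qsym_in_Inn by simp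
  have si: "inv\<^bsub>?G\<^esub> ?s \<in> carrier ?G" using s by simp
  have c: "?s \<otimes>\<^bsub>?G\<^esub> k \<otimes>\<^bsub>?G\<^esub> inv\<^bsub>?G\<^esub> ?s \<in> N" (is "?c \<in> N")
    using k s N.inv_op_closed2 by blast
  have im: "inv\<^bsub>?G\<^esub> m \<in> carrier ?G" using mn sub by simp
  have ky: "k y \<in> carrier Q" using k xy sub Inn_closed by blast
  have mk: "m (k y) = n y"
    using mn xy im by (simp add: k_def Inn_mult_apply sub Inn_closed Inn_inv_right)
  have "qsym Q (m x) (n y) = m (qsym Q x (k y))"
    using mn xy ky by (simp add: Inn_qsym sub mk)
  then have "quotient_map Q N (qsym Q (m x) (n y)) = quotient_map Q N (qsym Q x (k y))"
    using mn xy ky by (simp add: quotient_map_eq qsym_closed)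
  moreover have "?c (qsym Q x y) = qsym Q x (k y)"
  proof -
    have "?c (qsym Q x y) = (?s \<otimes>\<^bsub>?G\<^esub> k) ((inv\<^bsub>?G\<^esub> ?s) (?s y))"
      using xy s si k sub by (subst Inn_mult_apply) (auto simp: qsym_closed)
    also have "\<dots> = (?s \<otimes>\<^bsub>?G\<^esub> k) y" using Inn_inv_left[OF s xy(2)] xy by simp
    also have "\<dots> = qsym Q x (k y)" using s xy k sub ky by (simp add: Inn_mult_apply)
    finally show ?thesis .
  qed
  ultimately show ?thesis
    using quotient_map_eq[OF qsym_closed[OF xy] c] by simp
qed

lemma quotient_qsym:
  assumes "x \<in> carrier Q" "y \<in> carrier Q"
  shows "qsym (quotient_quandle Q N) (quotient_map Q N x) (quotient_map Q N y)
    = quotient_map Q N (qsym Q x y)"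
proof -
  have "quotient_map Q N (qsym Q x' y') = quotient_map Q N (qsym Q x y)"
    if "x' \<in> quotient_map Q N x" "y' \<in> quotient_map Q N y" for x' y'
    using that assms quotient_map_qsym_cong by (auto simp: quotient_map_iff)
  then show ?thesis
    using quotient_map_refl[OF assms(1)] quotient_map_refl[OF assms(2)]
    unfolding quotient_quandle_def quandle.simps by blast
qed

lemma quandle_quotient: "quandle (quotient_quandle Q N)"
proof
  have sub: "k \<in> carrier (Inn Q)" if "k \<in> N" for k using that N.subset by blast
  fix A assume "A \<in> carrier (quotient_quandle Q N)"
  then obtain x where x: "x \<in> carrier Q" "A = quotient_map Q N x"
    by (auto simp: carrier_quotient)
  show "qsym (quotient_quandle Q N) A A = A"
    using x by (simp add: quotient_qsym qsym_fix)
  have surj: "qsym Q x ` carrier Q = carrier Q"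
    using x qsym_bij by (simp add: bij_betw_def)
  have "inj_on (qsym (quotient_quandle Q N) A) (carrier (quotient_quandle Q N))"
  proof (rule inj_onI)
    fix B C assume "B \<in> carrier (quotient_quandle Q N)" "C \<in> carrier (quotient_quandle Q N)"
      and e: "qsym (quotient_quandle Q N) A B = qsym (quotient_quandle Q N) A C"
    then obtain y z where yz: "y \<in> carrier Q" "B = quotient_map Q N y"
      "z \<in> carrier Q" "C = quotient_map Q N z"
      by (auto simp: carrier_quotient)
    with e x obtain n where n: "n \<in> N" "qsym Q x z = n (qsym Q x y)"
      by (auto simp: quotient_qsym quotient_map_eq_iff qsym_closed)
    let ?s = "restrict (qsym Q x) (carrier Q)"
    have s: "?s \<in> carrier (Inn Q)" using x qsym_in_Inn by simp
    then have si: "inv\<^bsub>Inn Q\<^esub> ?s \<in> carrier (Inn Q)" by simp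
    have c: "inv\<^bsub>Inn Q\<^esub> ?s \<otimes>\<^bsub>Inn Q\<^esub> n \<otimes>\<^bsub>Inn Q\<^esub> ?s \<in> N" (is "?c \<in> N")
      using n s N.inv_op_closed1 by blast
    have "?c y = (inv\<^bsub>Inn Q\<^esub> ?s) (n (qsym Q x y))"
      using s si n sub yz x by (simp add: Inn_mult_apply qsym_closed)
    also have "\<dots> = (inv\<^bsub>Inn Q\<^esub> ?s) (?s z)" using n yz by simp
    also have "\<dots> = z" using s yz Inn_inv_left by blast
    finally show "B = C" using yz c quotient_map_eq by metis
  qed
  moreover have "qsym (quotient_quandle Q N) A ` carrier (quotient_quandle Q N) =
      quotient_map Q N ` (qsym Q x ` carrier Q)"
    using x by (force simp: carrier_quotient image_image quotient_qsym)
  ultimately show "bij_betw (qsym (quotient_quandle Q N) A)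
      (carrier (quotient_quandle Q N)) (carrier (quotient_quandle Q N))"
    by (simp add: bij_betw_def surj carrier_quotient)
  fix B C assume "B \<in> carrier (quotient_quandle Q N)" "C \<in> carrier (quotient_quandle Q N)"
  then obtain y z where "y \<in> carrier Q" "B = quotient_map Q N y"
    "z \<in> carrier Q" "C = quotient_map Q N z"
    by (auto simp: carrier_quotient)
  then show "qsym (quotient_quandle Q N) A (qsym (quotient_quandle Q N) B C) =
     qsym (quotient_quandle Q N) (qsym (quotient_quandle Q N) A B) (qsym (quotient_quandle Q N) A C)"
    using x qsym_distrib[of x y z] by (simp add: quotient_qsym qsym_closed)
qed

lemma surj_quandle_hom_quotient_map:
  "surj_quandle_hom Q (quotient_quandle Q N) (quotient_map Q N)"
  by (intro surj_quandle_hom.intro quandle_hom.intro quandle_hom_axioms.intro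
      surj_quandle_hom_axioms.intro quandle_quotient quandle_axioms)
    (auto simp: carrier_quotient quotient_qsym)

end

end

end

theory Submission
  imports Defs
begin

text \<open>
  Two surjective homomorphisms out of \<open>P\<close> are isomorphic as quotients iff they identify the same
  pairs of points. Hence \<open>f\<close> is isomorphic to \<open>\<pi>\<^sub>N\<close> iff the fibers of \<open>f\<close> are exactly the
  \<open>N\<close>-orbits. For connected \<open>f\<close> this holds with \<open>N = Inn_rel P Q f\<close>; conversely, if the fibers
  are the \<open>N\<close>-orbits, then \<open>N\<close> is contained in \<open>Inn_rel P Q f\<close>, which is therefore transitive on
  each fiber.
\<close>

context surj_quandle_hom
begin

text \<open>Since \<open>f\<close> is surjective, an element of \<open>Inn Q\<close> is determined
  by its values at the points \<open>f x\<close>. This trades the definite description in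
  \<open>induced_Inn\<close> for a pointwise condition.\<close>

lemma Inn_rel_iff:
  "\<phi> \<in> Inn_rel P Q f \<longleftrightarrow> \<phi> \<in> carrier (Inn P) \<and> (\<forall>x\<in>carrier P. f (\<phi> x) = f x)"
proof
  assume "\<phi> \<in> Inn_rel P Q f"
  then show "\<phi> \<in> carrier (Inn P) \<and> (\<forall>x\<in>carrier P. f (\<phi> x) = f x)"
    using Inn_rel_fiber[of \<phi>] by (auto simp: Inn_rel_def kernel_def fiber_def)
next
  assume \<phi>: "\<phi> \<in> carrier (Inn P) \<and> (\<forall>x\<in>carrier P. f (\<phi> x) = f x)"
  have "induced_Inn P Q f \<phi> = \<one>\<^bsub>Inn Q\<^esub>"
  proof (rule Q.Inn_eqI)
    show "induced_Inn P Q f \<phi> \<in> carrier (Inn Q)"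
      using \<phi> induced_Inn(1) by blast
    show "\<one>\<^bsub>Inn Q\<^esub> \<in> carrier (Inn Q)"
      using Q.group_Inn by (simp only: group.is_monoid monoid.one_closed)
    fix y assume y: "y \<in> carrier Q"
    then obtain x where "x \<in> carrier P" "y = f x"
      using surj by blast
    then show "induced_Inn P Q f \<phi> y = \<one>\<^bsub>Inn Q\<^esub> y"
      using \<phi> y induced_Inn(2)[of \<phi> x] by (simp add: Q.Inn_one)
  qed
  then show "\<phi> \<in> Inn_rel P Q f"
    using \<phi> by (simp add: Inn_rel_def kernel_def)
qed

lemma normal_Inn_rel: "Inn_rel P Q f \<lhd> Inn P"
  unfolding Inn_rel_def by (rule group_hom.normal_kernel[OF group_hom_induced_Inn])

text \<open>Surjectivity and the action on each fiber are already available here, so only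
  transitivity remains; a pair with equal images stands for two points of one fiber.\<close>

lemma connected_iff:
  "connected_quandle_hom P Q f \<longleftrightarrow>
    (\<forall>x\<in>carrier P. \<forall>y\<in>carrier P. f x = f y \<longrightarrow> (\<exists>\<phi>\<in>Inn_rel P Q f. y = \<phi> x))"
  using surj_quandle_hom_axioms group_action_fiber
  by (fastforce simp: connected_quandle_hom_def transitive_action_def
      transitive_action_axioms_def fiber_def f_closed)

lemma isomorphic_quotients_iff:
  assumes "surj_quandle_hom P R g"
  shows "isomorphic_quotients P Q f R g \<longleftrightarrow>
    (\<forall>x\<in>carrier P. \<forall>y\<in>carrier P. f x = f y \<longleftrightarrow> g x = g y)"
proof
  assume "isomorphic_quotients P Q f R g"
  then obtain \<theta> where \<theta>: "quandle_iso Q R \<theta>" "\<And>x. x \<in> carrier P \<Longrightarrow> \<theta> (f x) = g x"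
    by (auto simp: isomorphic_quotients_def)
  have "inj_on \<theta> (carrier Q)"
    using quandle_iso.bij[OF \<theta>(1)] by (rule bij_betw_imp_inj_on)
  then show "\<forall>x\<in>carrier P. \<forall>y\<in>carrier P. f x = f y \<longleftrightarrow> g x = g y"
    using \<theta>(2) f_closed by (metis inj_on_eq_iff)
next
  interpret g: surj_quandle_hom P R g by (rule assms)
  assume fg: "\<forall>x\<in>carrier P. \<forall>y\<in>carrier P. f x = f y \<longleftrightarrow> g x = g y"
  \<comment> \<open>The value at a point of \<open>Q\<close> is computed from a chosen preimage. The
    choice is harmless because, by \<open>fg\<close>, \<open>g\<close> is constant on the fibers of
    \<open>f\<close>; the converse half of \<open>fg\<close> will give injectivity.\<close>
  define \<theta> where "\<theta> = g \<circ> inv_into (carrier P) f"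
  have \<theta>: "\<theta> (f x) = g x" if "x \<in> carrier P" for x
    using that fg by (metis \<theta>_def comp_apply f_inv_into_f imageI inv_into_into)
  have "bij_betw \<theta> (carrier Q) (carrier R)"
  proof (rule bij_betw_imageI)
    show "inj_on \<theta> (carrier Q)"
      using fg \<theta> by (auto simp: surj[symmetric] intro!: inj_onI)
    show "\<theta> ` carrier Q = carrier R"
      using \<theta> by (simp add: surj[symmetric] g.surj[symmetric] image_image)
  qed
  moreover have "\<theta> (qsym Q p q) = qsym R (\<theta> p) (\<theta> q)"
    if pq: "p \<in> carrier Q" "q \<in> carrier Q" for p q
  proof -
    obtain x y where "x \<in> carrier P" "p = f x" "y \<in> carrier P" "q = f y"
      using pq surj by blast
    \<comment> \<open>Folding \<open>hom_qsym\<close> for \<open>f\<close> turns the left side into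
      \<theta> applied to \<open>f (qsym P x y)\<close>, which is \<open>g (qsym P x y)\<close>;
      then \<open>g\<close> being a homomorphism finishes.\<close>
    then show ?thesis
      by (simp add: \<theta> P.qsym_closed g.hom_qsym flip: hom_qsym)
  qed
  ultimately have "quandle_iso Q R \<theta>"
    by (intro quandle_iso.intro quandle_hom.intro quandle_hom_axioms.intro
        quandle_iso_axioms.intro Q.quandle_axioms g.Q.quandle_axioms bij_betw_imp_funcset)
  then show "isomorphic_quotients P Q f R g"
    using \<theta> by (auto simp: isomorphic_quotients_def)
qed

lemma isomorphic_quotient_map_iff:
  assumes "N \<lhd> Inn P"
  shows "isomorphic_quotients P Q f (quotient_quandle P N) (quotient_map P N) \<longleftrightarrow>
    (\<forall>x\<in>carrier P. \<forall>y\<in>carrier P. f x = f y \<longleftrightarrow> (\<exists>n\<in>N. y = n x))"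
  by (simp add: isomorphic_quotients_iff[OF P.surj_quandle_hom_quotient_map[OF assms]]
      P.quotient_map_eq_iff[OF assms])

end

theorem proposition0p1:
  fixes P :: "'a quandle" and Q :: "'b quandle" and f :: "'a \<Rightarrow> 'b"
  assumes "surj_quandle_hom P Q f"
  shows "connected_quandle_hom P Q f \<longleftrightarrow>
    (\<exists>N. N \<lhd> Inn P \<and> isomorphic_quotients P Q f (quotient_quandle P N) (quotient_map P N))"
proof -
  interpret surj_quandle_hom P Q f by (rule assms)
  show ?thesis
  proof
    assume "connected_quandle_hom P Q f"
    \<comment> \<open>Connectedness gives only the forward implication; the backward one holds
      because elements of \<open>Inn_rel P Q f\<close> preserve \<open>f\<close>.\<close>
    then have "\<forall>x\<in>carrier P. \<forall>y\<in>carrier P. f x = f y \<longleftrightarrow> (\<exists>\<phi>\<in>Inn_rel P Q f. y = \<phi> x)"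
      unfolding connected_iff using Inn_rel_iff by metis
    then show "\<exists>N. N \<lhd> Inn P \<and>
        isomorphic_quotients P Q f (quotient_quandle P N) (quotient_map P N)"
      using normal_Inn_rel isomorphic_quotient_map_iff by blast
  next
    assume "\<exists>N. N \<lhd> Inn P \<and>
      isomorphic_quotients P Q f (quotient_quandle P N) (quotient_map P N)"
    then obtain N where N: "N \<lhd> Inn P"
      and iff: "\<forall>x\<in>carrier P. \<forall>y\<in>carrier P. f x = f y \<longleftrightarrow> (\<exists>n\<in>N. y = n x)"
      using isomorphic_quotient_map_iff by blast
    have "N \<subseteq> carrier (Inn P)"
      using N by (intro subgroup.subset normal_imp_subgroup)
    \<comment> \<open>For \<open>n\<close> in \<open>N\<close>, the points \<open>x\<close> and
      \<open>n x\<close> lie in one \<open>N\<close>-orbit, so \<open>iff\<close> yields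
      \<open>f (n x) = f x\<close>.\<close>
    then have "N \<subseteq> Inn_rel P Q f"
      unfolding Inn_rel_iff subset_iff using iff P.Inn_closed by metis
    then show "connected_quandle_hom P Q f"
      unfolding connected_iff using iff by blast
  qed
qed

end
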